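(* Let $A$ be a commutative Banach algebra such that $\Delta(A)$ is nonempty. Then the following assertions are equivalent. (i) $C_{BSE}(\Delta(A))=\langle\Delta(A)\rangle^{*}$ as isometric Banach algebras; that is, the canonical map sending $\sigma\in C_{BSE}(\Delta(A))$ to the linear functional $\sum_{k=1}^n\lambda_k\varphi_k\mapsto\sum_{k=1}^n\lambda_k\sigma(\varphi_k)$ on $\langle\Delta(A)\rangle$ is an isometric algebra isomorphism of $C_{BSE}(\Delta(A))$ onto $\langle\Delta(A)\rangle^{*}$. (ii) The weak topology and the weak-* topology coincide on $\Delta(A)$.
   Context: Banach algebras are over $\mathbb C$; $A^*$ and $A^{**}$ are the dual and second dual of $A$. $\Delta(A)\subseteq A^*$ is the set of all nonzero multiplicative linear functionals on $A$, with the Gelfand (relative weak-* ) topology $\sigma(A^*,A)$ unless otherwise stated; the weak topology on $\Delta(A)$ is the relative topology $\sigma(A^*,A^{**})$. A bounded continuous function $\sigma:\Delta(A)\to\mathbb C$ is a BSE-function if there is $M>0$ such that $\left|\sum_{j=1}^n c_j\sigma(\varphi_j)\right|\le M\left\|\sum_{j=1}^n c_j\varphi_j\right\|_{A^*}$ for all finite choices $\varphi_1,\dots,\varphi_n\in\Delta(A)$ and $c_1,\dots,c_n\in\mathbb C$. The infimum of all such $M$ is $\|\sigma\|_{BSE}$. $C_{BSE}(\Delta(A))$ is the set of all BSE-functions; with pointwise operations and the norm $\|\cdot\|_{BSE}$ it is a commutative semisimple Banach algebra. $\langle\Delta(A)\rangle$ is the linear span of $\Delta(A)$ in $A^*$ with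 the norm of $A^*$, and $\langle\Delta(A)\rangle^*$ is its Banach space dual (the same as the dual of its norm closure). It is a Banach algebra under the product induced by the first Arens product of $A^{**}$, which is determined by $(F\,\square\,G)(\varphi)=F(\varphi)G(\varphi)$ for $F,G\in\langle\Delta(A)\rangle^*$, $\varphi\in\Delta(A)$. *)

theory Defs
  imports "HOL-Analysis.Analysis"
begin

section \<open>Complex normed spaces and Banach algebras\<close>

text \<open>Complex scalar multiplication is added on top of the real type classes of the library and
  is required to extend the real one, so that norm, topology and completeness are the library's.\<close>

class complex_vector = real_vector +
  fixes scaleC :: "complex \<Rightarrow> 'a \<Rightarrow> 'a"  (infixr \<open>*\<^sub>C\<close> 75)
  assumes scaleC_add_right: "c *\<^sub>C (x + y) = c *\<^sub>C x + c *\<^sub>C y"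
    and scaleC_add_left: "(c + d) *\<^sub>C x = c *\<^sub>C x + d *\<^sub>C x"
    and scaleC_scaleC: "c *\<^sub>C (d *\<^sub>C x) = (c * d) *\<^sub>C x"
    and scaleR_scaleC: "r *\<^sub>R x = complex_of_real r *\<^sub>C x"

lemma scaleC_one [simp]: "1 *\<^sub>C x = (x :: 'a::complex_vector)"
  using scaleR_scaleC[of 1 x] by simp

global_interpretation complex_vector: vector_space "scaleC :: complex \<Rightarrow> 'a \<Rightarrow> 'a::complex_vector"
  by standard (simp_all add: scaleC_add_right scaleC_add_left scaleC_scaleC)

class complex_normed_vector = complex_vector + real_normed_vector +
  assumes norm_scaleC: "norm (c *\<^sub>C x) = cmod c * norm x"

text \<open>No unit and no commutativity: a commutative Banach algebra is a type of sort
  \<open>{complex_banach_algebra, comm_ring}\<close>. Submultiplicativity of the norm is part of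
  \<open>real_normed_algebra\<close>.\<close>

class complex_banach_algebra = complex_normed_vector + real_normed_algebra + banach +
  assumes mult_scaleC_left: "(c *\<^sub>C x) * y = c *\<^sub>C (x * y)"
    and mult_scaleC_right: "x * (c *\<^sub>C y) = c *\<^sub>C (x * y)"

instantiation complex :: complex_banach_algebra
begin

definition scaleC_complex :: "complex \<Rightarrow> complex \<Rightarrow> complex"
  where "scaleC_complex c x = c * x"

instance
  by standard (simp_all add: scaleC_complex_def algebra_simps scaleR_conv_of_real norm_mult)

end


section \<open>The dual space\<close>

definition bounded_clinear :: "('a::complex_normed_vector \<Rightarrow> complex) \<Rightarrow> bool"
  where "bounded_clinear f \<longleftrightarrow> bounded_linear f \<and> (\<forall>c x. f (c *\<^sub>C x) = c * f x)"

typedef (overloaded) 'a cdual = "{f :: 'a::complex_normed_vector \<Rightarrow> complex. bounded_clinear f}"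
  morphisms cdual_apply Abs_cdual
  by (rule exI[of _ "\<lambda>_. 0"]) (simp add: bounded_clinear_def)

setup_lifting type_definition_cdual

lemma cdual_eqI: "(\<And>x. cdual_apply f x = cdual_apply g x) \<Longrightarrow> f = g"
  by (metis cdual_apply_inject ext)

instantiation cdual :: (complex_normed_vector) complex_normed_vector
begin

lift_definition zero_cdual :: "'a cdual" is "\<lambda>_. 0"
  by (simp add: bounded_clinear_def)

lift_definition uminus_cdual :: "'a cdual \<Rightarrow> 'a cdual" is "\<lambda>f x. - f x"
  by (simp add: bounded_clinear_def bounded_linear_minus)

lift_definition plus_cdual :: "'a cdual \<Rightarrow> 'a cdual \<Rightarrow> 'a cdual" is "\<lambda>f g x. f x + g x"
  by (simp add: bounded_clinear_def bounded_linear_add algebra_simps)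

lift_definition minus_cdual :: "'a cdual \<Rightarrow> 'a cdual \<Rightarrow> 'a cdual" is "\<lambda>f g x. f x - g x"
  by (simp add: bounded_clinear_def bounded_linear_sub algebra_simps)

lift_definition scaleC_cdual :: "complex \<Rightarrow> 'a cdual \<Rightarrow> 'a cdual" is "\<lambda>c f x. c * f x"
  by (simp add: bounded_clinear_def bounded_linear_const_mult algebra_simps)

lift_definition scaleR_cdual :: "real \<Rightarrow> 'a cdual \<Rightarrow> 'a cdual" is "\<lambda>r f x. complex_of_real r * f x"
  by (simp add: bounded_clinear_def bounded_linear_const_mult)

lift_definition norm_cdual :: "'a cdual \<Rightarrow> real" is onorm .

definition dist_cdual :: "'a cdual \<Rightarrow> 'a cdual \<Rightarrow> real"
  where "dist_cdual f g = norm (f - g)"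

definition sgn_cdual :: "'a cdual \<Rightarrow> 'a cdual"
  where "sgn_cdual f = inverse (norm f) *\<^sub>R f"

definition uniformity_cdual :: "('a cdual \<times> 'a cdual) filter"
  where "uniformity_cdual = (INF e\<in>{0<..}. principal {(f, g). dist f g < e})"

definition open_cdual :: "'a cdual set \<Rightarrow> bool"
  where "open_cdual U = (\<forall>f\<in>U. \<forall>\<^sub>F (f', g) in uniformity. f' = f \<longrightarrow> g \<in> U)"

instance
proof
  fix f g h :: "'a cdual" and c d :: complex and r s :: real
  show "f + g + h = f + (g + h)" by transfer (simp add: algebra_simps)
  show "f + g = g + f" by transfer (simp add: algebra_simps)
  show "0 + f = f" by transfer simp
  show "- f + f = 0" by transfer simp
  show "f - g = f + - g" by transfer simp
  show "r *\<^sub>R (f + g) = r *\<^sub>R f + r *\<^sub>R g" by transfer (simp add: algebra_simps)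
  show "(r + s) *\<^sub>R f = r *\<^sub>R f + s *\<^sub>R f" by transfer (simp add: algebra_simps)
  show "r *\<^sub>R s *\<^sub>R f = (r * s) *\<^sub>R f" by transfer (simp add: algebra_simps)
  show "1 *\<^sub>R f = f" by transfer simp
  show "c *\<^sub>C (f + g) = c *\<^sub>C f + c *\<^sub>C g" by transfer (simp add: algebra_simps)
  show "(c + d) *\<^sub>C f = c *\<^sub>C f + d *\<^sub>C f" by transfer (simp add: algebra_simps)
  show "c *\<^sub>C d *\<^sub>C f = (c * d) *\<^sub>C f" by transfer (simp add: algebra_simps)
  show "r *\<^sub>R f = complex_of_real r *\<^sub>C f" by transfer simp
  show "dist f g = norm (f - g)" by (simp add: dist_cdual_def)
  show "sgn f = inverse (norm f) *\<^sub>R f" by (simp add: sgn_cdual_def)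
  show "uniformity = (INF e\<in>{0<..}. principal {(f :: 'a cdual, g). dist f g < e})"
    by (rule uniformity_cdual_def)
  show "open U = (\<forall>f\<in>U. \<forall>\<^sub>F (f', g) in uniformity. f' = f \<longrightarrow> g \<in> U)" for U :: "'a cdual set"
    by (rule open_cdual_def)
  show "(norm f = 0) = (f = 0)"
    by transfer (auto simp: bounded_clinear_def onorm_eq_0)
  show "norm (f + g) \<le> norm f + norm g"
    by transfer (auto simp: bounded_clinear_def intro: onorm_triangle)
  have scale: "onorm (\<lambda>x. c * u x) = cmod c * onorm u" if "bounded_clinear u"
    for u :: "'a \<Rightarrow> complex" and c
  proof -
    have u: "bounded_linear u" using that by (simp add: bounded_clinear_def)
    have le: "onorm (\<lambda>x. c * u x) \<le> cmod c * onorm u" if "bounded_linear u" for c and u :: "'a \<Rightarrow> complex"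
    proof (rule onorm_bound)
      show "0 \<le> cmod c * onorm u" using onorm_pos_le[OF that] by simp
      show "norm (c * u x) \<le> cmod c * onorm u * norm x" for x
        using mult_left_mono[OF onorm[OF that, of x], of "cmod c"] by (simp add: norm_mult algebra_simps)
    qed
    show ?thesis
    proof (cases "c = 0")
      case False
      have "onorm (\<lambda>x. inverse c * (c * u x)) \<le> cmod (inverse c) * onorm (\<lambda>x. c * u x)"
        by (rule le) (rule bounded_linear_const_mult[OF u])
      then have "cmod c * onorm u \<le> onorm (\<lambda>x. c * u x)"
        using False by (simp add: norm_inverse mult.assoc[symmetric]) (simp add: field_simps)
      then show ?thesis using le[OF u, of c] by simp
    qed (simp add: onorm_zero)
  qed
  show "norm (r *\<^sub>R f) = \<bar>r\<bar> * norm f"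
    by transfer (simp add: scale)
  show "norm (c *\<^sub>C f) = cmod c * norm f"
    by transfer (simp add: scale)
qed

end

lemma cdual_apply_simps [simp]:
  "cdual_apply 0 x = 0"
  "cdual_apply (- f) x = - cdual_apply f x"
  "cdual_apply (f + g) x = cdual_apply f x + cdual_apply g x"
  "cdual_apply (f - g) x = cdual_apply f x - cdual_apply g x"
  "cdual_apply (c *\<^sub>C f) x = c * cdual_apply f x"
  by (transfer, simp)+

lemma bounded_clinear_cdual_apply: "bounded_clinear (cdual_apply f)"
  using cdual_apply[of f] by simp

lemma norm_cdual_apply_le: "cmod (cdual_apply f x) \<le> norm f * norm x"
  by transfer (use onorm bounded_clinear_def in blast)

text \<open>The topologies \<open>\<sigma>(X, X\<^sup>*)\<close> on \<open>X\<close> and \<open>\<sigma>(X\<^sup>*, X)\<close> on \<open>X\<^sup>*\<close>; for \<open>X = A\<^sup>*\<close> the former is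
  \<open>\<sigma>(A\<^sup>*, A\<^sup>*\<^sup>*)\<close>.\<close>

definition weak_topology :: "'a::complex_normed_vector topology"
  where "weak_topology =
    topology_generated_by {{x. cdual_apply f x \<in> U} |f U. open (U :: complex set)}"

definition weak_star_topology :: "'a::complex_normed_vector cdual topology"
  where "weak_star_topology =
    topology_generated_by {{f. cdual_apply f x \<in> U} |x U. open (U :: complex set)}"

text \<open>The dual of a linear subspace \<open>S\<close>. Its elements are functions on \<open>S\<close> only, so they are made
  \<open>extensional\<close> to be determined by their values on \<open>S\<close>.\<close>

definition dual_on :: "'a::complex_normed_vector set \<Rightarrow> ('a \<Rightarrow> complex) set"
  where "dual_on S = {F \<in> extensional S.
     (\<forall>x\<in>S. \<forall>y\<in>S. F (x + y) = F x + F y) \<and>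
     (\<forall>c. \<forall>x\<in>S. F (c *\<^sub>C x) = c * F x) \<and>
     (\<exists>M. \<forall>x\<in>S. cmod (F x) \<le> M * norm x)}"

lemma dual_on_UNIV: "dual_on UNIV = range cdual_apply"
proof (intro subset_antisym subsetI)
  fix F :: "'a \<Rightarrow> complex"
  assume F: "F \<in> dual_on UNIV"
  then have ex: "\<exists>M. \<forall>x. cmod (F x) \<le> M * norm x"
    and F': "\<And>x y. F (x + y) = F x + F y" "\<And>c x. F (c *\<^sub>C x) = c * F x"
    unfolding dual_on_def by simp_all
  from ex obtain M where M: "\<And>x. cmod (F x) \<le> M * norm x" by blast
  have "bounded_linear F"
  proof (rule bounded_linear_intro)
    show "F (x + y) = F x + F y" for x y by (rule F')
    show "F (r *\<^sub>R x) = r *\<^sub>R F x" for r x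
      by (simp only: scaleR_scaleC[of r x] F'(2) scaleR_conv_of_real)
    show "norm (F x) \<le> norm x * M" for x using M[of x] by (simp only: mult.commute)
  qed
  then have "bounded_clinear F" unfolding bounded_clinear_def using F'(2) by blast
  then have "F = cdual_apply (Abs_cdual F)" by (simp add: Abs_cdual_inverse)
  then show "F \<in> range cdual_apply" by (rule range_eqI)
next
  fix F :: "'a \<Rightarrow> complex"
  assume "F \<in> range cdual_apply"
  then obtain f where f: "F = cdual_apply f" by blast
  have lin: "linear (cdual_apply f)" and scale: "\<And>c x. cdual_apply f (c *\<^sub>C x) = c * cdual_apply f x"
    using bounded_clinear_cdual_apply[of f] by (simp_all add: bounded_clinear_def bounded_linear.linear)
  show "F \<in> dual_on UNIV"
    unfolding dual_on_def f
  proof (intro CollectI conjI ballI allI)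
    show "cdual_apply f \<in> extensional UNIV" by simp
    show "\<exists>M. \<forall>x\<in>UNIV. cmod (cdual_apply f x) \<le> M * norm x"
      using norm_cdual_apply_le[of f] by blast
  qed (simp_all only: linear_add[OF lin] scale)
qed

definition dual_norm_on :: "'a::complex_normed_vector set \<Rightarrow> ('a \<Rightarrow> complex) \<Rightarrow> real"
  where "dual_norm_on S F = Sup {cmod (F x) |x. x \<in> S \<and> norm x \<le> 1}"


section \<open>The Gelfand space and its span\<close>

definition gelfand_space :: "'a::complex_banach_algebra cdual set"  (\<open>\<Delta>\<close>)
  where "\<Delta> = {\<phi>. \<phi> \<noteq> 0 \<and> (\<forall>a b. cdual_apply \<phi> (a * b) = cdual_apply \<phi> a * cdual_apply \<phi> b)}"

abbreviation span_gelfand :: "'a::complex_banach_algebra cdual set"  (\<open>\<langle>\<Delta>\<rangle>\<close>)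
  where "\<langle>\<Delta>\<rangle> \<equiv> complex_vector.span \<Delta>"

text \<open>The three steps \<open>(f \<cdot> a)(b) = f (a b)\<close>, \<open>(G \<cdot> f)(a) = G (f \<cdot> a)\<close>, \<open>(F \<box> G)(f) = F (G \<cdot> f)\<close> of
  the first Arens product. For \<open>S = UNIV\<close> this is the first Arens product of \<open>A\<^sup>*\<^sup>*\<close>; for
  \<open>S = \<langle>\<Delta>\<rangle>\<close>, which is stable under the first two steps, it is the product on \<open>\<langle>\<Delta>\<rangle>\<^sup>*\<close> that it
  induces by restriction (see \<open>arens_restrict\<close> and \<open>arens_gelfand\<close> below).\<close>

definition arens_act_right :: "'a::complex_banach_algebra cdual \<Rightarrow> 'a \<Rightarrow> 'a cdual"
  where "arens_act_right f a = Abs_cdual (\<lambda>b. cdual_apply f (a * b))"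

definition arens_act_left ::
    "('a::complex_banach_algebra cdual \<Rightarrow> complex) \<Rightarrow> 'a cdual \<Rightarrow> 'a cdual"
  where "arens_act_left G f = Abs_cdual (\<lambda>a. G (arens_act_right f a))"

definition arens :: "'a::complex_banach_algebra cdual set \<Rightarrow>
    ('a cdual \<Rightarrow> complex) \<Rightarrow> ('a cdual \<Rightarrow> complex) \<Rightarrow> 'a cdual \<Rightarrow> complex"
  where "arens S F G = (\<lambda>f\<in>S. F (arens_act_left G f))"

lemma arens_act_right_apply [simp]:
  "cdual_apply (arens_act_right f a) b = cdual_apply f (a * b)"
proof -
  have "bounded_clinear (\<lambda>b. cdual_apply f (a * b))"
    using bounded_clinear_cdual_apply[of f]
    by (auto simp: bounded_clinear_def mult_scaleC_right
        intro: bounded_linear_compose bounded_linear_mult_right)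
  then show ?thesis by (simp add: arens_act_right_def Abs_cdual_inverse)
qed

lemma arens_act_right_add: "arens_act_right (f + g) a = arens_act_right f a + arens_act_right g a"
  and arens_act_right_scaleC: "arens_act_right (c *\<^sub>C f) a = c *\<^sub>C arens_act_right f a"
  and arens_act_right_zero: "arens_act_right 0 a = 0"
  by (rule cdual_eqI, simp)+

lemma arens_act_right_gelfand:
  assumes "\<phi> \<in> \<Delta>" shows "arens_act_right \<phi> a = cdual_apply \<phi> a *\<^sub>C \<phi>"
  using assms by (intro cdual_eqI) (simp add: gelfand_space_def)

lemma arens_act_right_span:
  assumes "f \<in> \<langle>\<Delta>\<rangle>" shows "arens_act_right f a \<in> \<langle>\<Delta>\<rangle>"
  using assms
proof (induction rule: complex_vector.span_induct_alt)
  case base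
  show ?case by (simp add: arens_act_right_zero complex_vector.span_zero)
next
  case (step c \<phi> f)
  then show ?case
    by (simp add: arens_act_right_add arens_act_right_scaleC arens_act_right_gelfand
        complex_vector.span_add complex_vector.span_scale complex_vector.span_base)
qed

lemma arens_act_left_gelfand:
  assumes G: "G \<in> dual_on S" and S: "\<langle>\<Delta>\<rangle> \<subseteq> S" and \<phi>: "\<phi> \<in> \<Delta>"
  shows "arens_act_left G \<phi> = G \<phi> *\<^sub>C \<phi>"
proof -
  have "\<phi> \<in> S" using S \<phi> complex_vector.span_base by blast
  then have "(\<lambda>a. G (arens_act_right \<phi> a)) = cdual_apply (G \<phi> *\<^sub>C \<phi>)"
    using G by (simp add: arens_act_right_gelfand[OF \<phi>] dual_on_def fun_eq_iff)
  then show ?thesis by (simp add: arens_act_left_def cdual_apply_inverse)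
qed

lemma arens_act_left_restrict:
  assumes "f \<in> \<langle>\<Delta>\<rangle>" shows "arens_act_left (restrict G \<langle>\<Delta>\<rangle>) f = arens_act_left G f"
  using assms by (simp add: arens_act_left_def arens_act_right_span)

lemma arens_act_left_span_ex:
  assumes G: "G \<in> dual_on \<langle>\<Delta>\<rangle>" and f: "f \<in> \<langle>\<Delta>\<rangle>"
  shows "f \<in> \<langle>\<Delta>\<rangle> \<and> (\<exists>g\<in>\<langle>\<Delta>\<rangle>. \<forall>a. cdual_apply g a = G (arens_act_right f a))"
  using f
proof (induction rule: complex_vector.span_induct_alt)
  case base
  have "G (0 *\<^sub>C 0) = 0 * G 0"
    using G complex_vector.span_zero unfolding dual_on_def by blast
  then have "G 0 = 0" by simp
  then show ?case
    by (intro conjI bexI[of _ 0]) (simp_all add: arens_act_right_zero complex_vector.span_zero)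
next
  case (step c \<phi> f)
  then obtain g where g: "g \<in> \<langle>\<Delta>\<rangle>" "\<And>a. cdual_apply g a = G (arens_act_right f a)" by blast
  have \<phi>: "\<phi> \<in> \<langle>\<Delta>\<rangle>" using step(1) by (rule complex_vector.span_base)
  have f: "f \<in> \<langle>\<Delta>\<rangle>" using step(2) by simp
  have "cdual_apply (c *\<^sub>C G \<phi> *\<^sub>C \<phi> + g) a = G (arens_act_right (c *\<^sub>C \<phi> + f) a)" for a
  proof -
    have "G (arens_act_right (c *\<^sub>C \<phi> + f) a) = c * G (arens_act_right \<phi> a) + G (arens_act_right f a)"
      using G arens_act_right_span[OF \<phi>, of a] arens_act_right_span[OF f, of a]
      by (simp add: dual_on_def arens_act_right_add arens_act_right_scaleC complex_vector.span_scale)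
    also have "G (arens_act_right \<phi> a) = cdual_apply \<phi> a * G \<phi>"
      using G \<phi> by (simp add: arens_act_right_gelfand[OF step(1)] dual_on_def)
    finally show ?thesis by (simp add: g(2))
  qed
  moreover have "c *\<^sub>C G \<phi> *\<^sub>C \<phi> + g \<in> \<langle>\<Delta>\<rangle>"
    using \<phi> g(1) by (intro complex_vector.span_add complex_vector.span_scale)
  moreover have "c *\<^sub>C \<phi> + f \<in> \<langle>\<Delta>\<rangle>"
    using \<phi> f by (intro complex_vector.span_add complex_vector.span_scale)
  ultimately show ?case by blast
qed

lemma arens_act_left_span:
  assumes "G \<in> dual_on \<langle>\<Delta>\<rangle>" "f \<in> \<langle>\<Delta>\<rangle>"
  shows "arens_act_left G f \<in> \<langle>\<Delta>\<rangle>"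
proof -
  obtain g where g: "g \<in> \<langle>\<Delta>\<rangle>" "\<forall>a. cdual_apply g a = G (arens_act_right f a)"
    using arens_act_left_span_ex[OF assms] by blast
  then have "arens_act_left G f = g"
    by (simp add: arens_act_left_def cdual_apply_inverse flip: g(2)[rule_format])
  then show ?thesis using g(1) by simp
qed

lemma restrict_dual_on:
  assumes "F \<in> dual_on UNIV"
  shows "restrict F \<langle>\<Delta>\<rangle> \<in> dual_on \<langle>\<Delta>\<rangle>"
  using assms by (auto simp: dual_on_def complex_vector.span_add complex_vector.span_scale)

lemma arens_restrict:
  assumes "F \<in> dual_on UNIV" "G \<in> dual_on UNIV"
  shows "restrict (arens UNIV F G) \<langle>\<Delta>\<rangle> = arens \<langle>\<Delta>\<rangle> (restrict F \<langle>\<Delta>\<rangle>) (restrict G \<langle>\<Delta>\<rangle>)"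
proof
  fix f :: "'a cdual"
  show "restrict (arens UNIV F G) \<langle>\<Delta>\<rangle> f = arens \<langle>\<Delta>\<rangle> (restrict F \<langle>\<Delta>\<rangle>) (restrict G \<langle>\<Delta>\<rangle>) f"
    using arens_act_left_span[OF restrict_dual_on[OF assms(2)], of f]
    by (cases "f \<in> \<langle>\<Delta>\<rangle>") (simp_all add: arens_def arens_act_left_restrict)
qed

lemma arens_gelfand:
  assumes "F \<in> dual_on \<langle>\<Delta>\<rangle>" "G \<in> dual_on \<langle>\<Delta>\<rangle>" "\<phi> \<in> \<Delta>"
  shows "arens \<langle>\<Delta>\<rangle> F G \<phi> = F \<phi> * G \<phi>"
  using assms complex_vector.span_base[of \<phi> \<Delta>]
  by (simp add: arens_def arens_act_left_gelfand[OF _ subset_refl] dual_on_def)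


section \<open>Normed algebras with a carrier and their isomorphisms\<close>

record 'x normed_alg =
  na_carrier :: "'x set"
  na_add :: "'x \<Rightarrow> 'x \<Rightarrow> 'x"
  na_scale :: "complex \<Rightarrow> 'x \<Rightarrow> 'x"
  na_mult :: "'x \<Rightarrow> 'x \<Rightarrow> 'x"
  na_norm :: "'x \<Rightarrow> real"

definition isometric_algebra_iso :: "'x normed_alg \<Rightarrow> 'y normed_alg \<Rightarrow> ('x \<Rightarrow> 'y) \<Rightarrow> bool"
  where "isometric_algebra_iso X Y h \<longleftrightarrow>
    bij_betw h (na_carrier X) (na_carrier Y) \<and>
    (\<forall>x\<in>na_carrier X. \<forall>y\<in>na_carrier X. h (na_add X x y) = na_add Y (h x) (h y)) \<and>
    (\<forall>c. \<forall>x\<in>na_carrier X. h (na_scale X c x) = na_scale Y c (h x)) \<and>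
    (\<forall>x\<in>na_carrier X. \<forall>y\<in>na_carrier X. h (na_mult X x y) = na_mult Y (h x) (h y)) \<and>
    (\<forall>x\<in>na_carrier X. na_norm Y (h x) = na_norm X x)"

definition dual_span_gelfand :: "('a::complex_banach_algebra cdual \<Rightarrow> complex) normed_alg"
  where "dual_span_gelfand =
    \<lparr> na_carrier = dual_on \<langle>\<Delta>\<rangle>,
      na_add = (\<lambda>F G. \<lambda>f\<in>\<langle>\<Delta>\<rangle>. F f + G f),
      na_scale = (\<lambda>c F. \<lambda>f\<in>\<langle>\<Delta>\<rangle>. c * F f),
      na_mult = arens \<langle>\<Delta>\<rangle>,
      na_norm = dual_norm_on \<langle>\<Delta>\<rangle> \<rparr>"


section \<open>BSE-functions\<close>

definition bse_bound :: "('a::complex_banach_algebra cdual \<Rightarrow> complex) \<Rightarrow> real \<Rightarrow> bool"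
  where "bse_bound \<sigma> M \<longleftrightarrow>
    (\<forall>n (c :: nat \<Rightarrow> complex) \<phi>. (\<forall>j<n. \<phi> j \<in> \<Delta>) \<longrightarrow>
      cmod (\<Sum>j<n. c j * \<sigma> (\<phi> j)) \<le> M * norm (\<Sum>j<n. c j *\<^sub>C \<phi> j))"

text \<open>As with \<open>dual_on\<close>, functions on \<open>\<Delta>\<close> are represented by extensional functions.\<close>

definition bse_functions :: "('a::complex_banach_algebra cdual \<Rightarrow> complex) set"
  where "bse_functions = {\<sigma> \<in> extensional \<Delta>.
    bounded (\<sigma> ` \<Delta>) \<and>
    continuous_map (subtopology weak_star_topology \<Delta>) euclidean \<sigma> \<and>
    (\<exists>M>0. bse_bound \<sigma> M)}"

definition bse_norm :: "('a::complex_banach_algebra cdual \<Rightarrow> complex) \<Rightarrow> real"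
  where "bse_norm \<sigma> = Inf {M. M > 0 \<and> bse_bound \<sigma> M}"

definition C_BSE :: "('a::complex_banach_algebra cdual \<Rightarrow> complex) normed_alg"
  where "C_BSE =
    \<lparr> na_carrier = bse_functions,
      na_add = (\<lambda>\<sigma> \<tau>. \<lambda>\<phi>\<in>\<Delta>. \<sigma> \<phi> + \<tau> \<phi>),
      na_scale = (\<lambda>c \<sigma>. \<lambda>\<phi>\<in>\<Delta>. c * \<sigma> \<phi>),
      na_mult = (\<lambda>\<sigma> \<tau>. \<lambda>\<phi>\<in>\<Delta>. \<sigma> \<phi> * \<tau> \<phi>),
      na_norm = bse_norm \<rparr>"

text \<open>The value at \<open>f\<close> is the common value of \<open>\<Sum>k<n. c k * \<sigma> (\<phi> k)\<close> over all representations
  \<open>f = (\<Sum>k<n. c k *\<^sub>C \<phi> k)\<close>; for BSE-functions it does not depend on the representation.\<close>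

definition bse_to_dual ::
    "('a::complex_banach_algebra cdual \<Rightarrow> complex) \<Rightarrow> 'a cdual \<Rightarrow> complex"
  where "bse_to_dual \<sigma> = (\<lambda>f\<in>\<langle>\<Delta>\<rangle>. THE w. \<exists>n (c :: nat \<Rightarrow> complex) \<phi>.
    (\<forall>k<n. \<phi> k \<in> \<Delta>) \<and> f = (\<Sum>k<n. c k *\<^sub>C \<phi> k) \<and> w = (\<Sum>k<n. c k * \<sigma> (\<phi> k)))"

lemma bse_to_dual_sum:
  fixes c :: "nat \<Rightarrow> complex"
  assumes \<sigma>: "\<sigma> \<in> bse_functions" and \<phi>: "\<And>k. k < n \<Longrightarrow> \<phi> k \<in> \<Delta>"
  shows "bse_to_dual \<sigma> (\<Sum>k<n. c k *\<^sub>C \<phi> k) = (\<Sum>k<n. c k * \<sigma> (\<phi> k))"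
proof -
  obtain M where M: "bse_bound \<sigma> M" using \<sigma> by (auto simp: bse_functions_def)
  have unique: "(\<Sum>k<m. d k * \<sigma> (\<psi> k)) = (\<Sum>k<n. c k * \<sigma> (\<phi> k))"
    if \<psi>: "\<forall>k<m. \<psi> k \<in> \<Delta>" and eq: "(\<Sum>k<n. c k *\<^sub>C \<phi> k) = (\<Sum>k<m. d k *\<^sub>C \<psi> k)"
    for m \<psi> and d :: "nat \<Rightarrow> complex"
  proof -
    define e where "e k = (if k < n then c k else - d (k - n))" for k
    define \<theta> where "\<theta> k = (if k < n then \<phi> k else \<psi> (k - n))" for k
    have split: "(\<Sum>k<n + m. h k) = (\<Sum>k<n. h k) + (\<Sum>k<m. h (n + k))"
      for h :: "nat \<Rightarrow> 'z::comm_monoid_add"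
      by (induction m) (simp_all add: add.assoc)
    have "cmod (\<Sum>k<n + m. e k * \<sigma> (\<theta> k)) \<le> M * norm (\<Sum>k<n + m. e k *\<^sub>C \<theta> k)"
      using M \<phi> \<psi> unfolding bse_bound_def by (auto simp: \<theta>_def)
    also have "(\<Sum>k<n + m. e k *\<^sub>C \<theta> k) = 0"
      unfolding split by (simp add: e_def \<theta>_def eq sum_negf)
    finally have "(\<Sum>k<n + m. e k * \<sigma> (\<theta> k)) = 0" by simp
    then show ?thesis unfolding split by (simp add: e_def \<theta>_def sum_negf)
  qed
  have "(\<Sum>k<n. c k *\<^sub>C \<phi> k) \<in> \<langle>\<Delta>\<rangle>"
    by (rule complex_vector.span_sum, rule complex_vector.span_scale, rule complex_vector.span_base)
      (simp add: \<phi>)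
  then have "bse_to_dual \<sigma> (\<Sum>k<n. c k *\<^sub>C \<phi> k) =
    (THE w. \<exists>m (d :: nat \<Rightarrow> complex) \<psi>. (\<forall>k<m. \<psi> k \<in> \<Delta>) \<and>
      (\<Sum>k<n. c k *\<^sub>C \<phi> k) = (\<Sum>k<m. d k *\<^sub>C \<psi> k) \<and> w = (\<Sum>k<m. d k * \<sigma> (\<psi> k)))"
    by (simp only: bse_to_dual_def restrict_apply if_True)
  also have "\<dots> = (\<Sum>k<n. c k * \<sigma> (\<phi> k))"
  proof (rule the_equality)
    show "\<exists>m (d :: nat \<Rightarrow> complex) \<psi>. (\<forall>k<m. \<psi> k \<in> \<Delta>) \<and>
        (\<Sum>k<n. c k *\<^sub>C \<phi> k) = (\<Sum>k<m. d k *\<^sub>C \<psi> k) \<and>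
        (\<Sum>k<n. c k * \<sigma> (\<phi> k)) = (\<Sum>k<m. d k * \<sigma> (\<psi> k))"
      using \<phi> by (intro exI[of _ n] exI[of _ c] exI[of _ \<phi>]) simp
  qed (elim exE conjE, simp only: unique)
  finally show ?thesis .
qed

end

theory Submission
  imports Defs
begin

text \<open>The map \<open>bse_to_dual\<close> is always an isometric homomorphism, with
  \<open>F \<mapsto> restrict F \<Delta>\<close> as the only candidate for its inverse. So (i) says that every functional in
  \<open>\<langle>\<Delta>\<rangle>\<^sup>*\<close> is weak-* continuous on \<open>\<Delta>\<close>. By the Hahn-Banach theorem these functionals
  are the restrictions of the elements of \<open>A\<^sup>*\<^sup>*\<close>, so this is (ii).\<close>

section \<open>The Hahn-Banach theorem\<close>

text \<open>The BSE inequality, applied to the difference of two representations, makes the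
  canonical map well defined. The constants it admits are exactly the bounds of the resulting
  functional, which gives the isometry. Conversely, characters have norm at most 1, so restricting a
  functional to \<Delta> always gives a bounded function with the BSE inequality; continuity is the
  only obstruction to surjectivity. All identities between functionals are checked at characters,
  which span the domain and on which the Arens product is pointwise. As for the topologies,
  evaluations at points of A lie in the second dual, so on \<Delta> the weak topology always refines
  the weak-* one and (ii) asks for one inclusion only. The Hahn-Banach theorem has to turn a
  functional on the span, in general a proper subspace of the dual, into an element of the second
  dual with the same values at characters. It is proved for real scalars with a sublinear majorant
  and then transferred to complex ones.\<close>

text \<open>Linear functionals below \<open>p\<close> are represented by their graphs. A subspace of the product below
  the graph of \<open>p\<close> is automatically single-valued, because \<open>p 0 = 0\<close>.\<close>

lemma dominated_subspace_unique:
  fixes p :: "'a::real_vector \<Rightarrow> real"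
  assumes p0: "p 0 = 0" and G: "subspace G" and le: "\<And>x a. (x, a) \<in> G \<Longrightarrow> a \<le> p x"
    and "(x, a) \<in> G" "(x, b) \<in> G"
  shows "a = b"
proof -
  have "(0, a - b) \<in> G" "(0, b - a) \<in> G"
    using subspace_diff[OF G assms(4,5)] subspace_diff[OF G assms(5,4)] by simp_all
  then show ?thesis using le[of 0 "a - b"] le[of 0 "b - a"] p0 by simp
qed

text \<open>A value \<open>c\<close> at \<open>x0\<close> must satisfy
  \<open>a - c \<le> p (x - x0)\<close> and \<open>b + c \<le> p (y + x0)\<close> for all
  \<open>(x, a)\<close> and \<open>(y, b)\<close> in \<open>G\<close>. Subadditivity puts every
  lower bound for \<open>c\<close> below every upper one, and the supremum of the lower bounds is
  chosen. Other multiples of \<open>x0\<close> reduce to these two cases by positive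
  homogeneity.\<close>

lemma dominated_subspace_extend:
  fixes p :: "'a::real_vector \<Rightarrow> real"
  assumes add: "\<And>x y. p (x + y) \<le> p x + p y"
    and scale: "\<And>t x. t \<ge> 0 \<Longrightarrow> p (t *\<^sub>R x) = t * p x"
    and G: "subspace G" and le: "\<And>x a. (x, a) \<in> G \<Longrightarrow> a \<le> p x"
  obtains c where "\<And>x a. (x, a) \<in> span (insert (x0, c) G) \<Longrightarrow> a \<le> p x"
proof -
  define L where "L = {a - p (x - x0) |x a. (x, a) \<in> G}"
  have sep: "a - p (x - x0) \<le> p (y + x0) - b" if "(x, a) \<in> G" "(y, b) \<in> G" for x a y b
  proof -
    have "a + b \<le> p (x + y)" using le subspace_add[OF G that] by simp
    also have "\<dots> \<le> p (x - x0) + p (y + x0)" using add[of "x - x0" "y + x0"] by simp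
    finally show ?thesis by simp
  qed
  have 0: "(0, 0) \<in> G" using subspace_0[OF G] by (simp add: zero_prod_def)
  have bdd: "bdd_above L"
    unfolding L_def by (rule bdd_aboveI[of _ "p (0 + x0) - 0"]) (use sep[OF _ 0] in blast)
  define c where "c = Sup L"
  have lower: "a - p (x - x0) \<le> c" if "(x, a) \<in> G" for x a
    unfolding c_def by (rule cSup_upper[OF _ bdd]) (use that L_def in blast)
  have upper: "c \<le> p (y + x0) - b" if "(y, b) \<in> G" for y b
    unfolding c_def
  proof (rule cSup_least)
    show "L \<noteq> {}" using 0 L_def by blast
  qed (use sep[OF _ that] L_def in blast)
  have "a \<le> p x" if xa: "(x, a) \<in> span (insert (x0, c) G)" for x a
  proof -
    obtain t where t: "(x - t *\<^sub>R x0, a - t * c) \<in> G"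
      using xa unfolding span_insert span_eq_iff[THEN iffD2, OF G] by auto
    have scaled: "(r *\<^sub>R (x - t *\<^sub>R x0), r * (a - t * c)) \<in> G" for r
      using subspace_scale[OF G t, of r] by simp
    consider "t = 0" | "t > 0" | "t < 0" by linarith
    then show ?thesis
    proof cases
      case 1
      then show ?thesis using le[OF t] by simp
    next
      case 2
      have "c \<le> p (inverse t *\<^sub>R (x - t *\<^sub>R x0) + x0) - inverse t * (a - t * c)"
        by (rule upper[OF scaled])
      also have "inverse t *\<^sub>R (x - t *\<^sub>R x0) + x0 = inverse t *\<^sub>R x"
        using 2 by (simp add: scaleR_right_diff_distrib)
      finally show ?thesis using 2 by (simp add: scale field_simps)
    next
      case 3
      define s where "s = - t"
      have s: "s > 0" "t = - s" using 3 by (simp_all add: s_def)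
      have "inverse s * (a - t * c) - p (inverse s *\<^sub>R (x - t *\<^sub>R x0) - x0) \<le> c"
        by (rule lower[OF scaled])
      also have "inverse s *\<^sub>R (x - t *\<^sub>R x0) - x0 = inverse s *\<^sub>R x"
        using s by (simp add: scaleR_right_distrib)
      finally show ?thesis using s by (simp add: scale field_simps)
    qed
  qed
  then show ?thesis by (rule that)
qed

text \<open>Linearity of \<open>g\<close> is assumed on \<open>S\<close> only, to suit the members
  of \<open>dual_on S\<close>: these are extensional and need not be linear outside
  \<open>S\<close>.\<close>

theorem Hahn_Banach:
  fixes p :: "'a::real_vector \<Rightarrow> real"
  assumes add: "\<And>x y. p (x + y) \<le> p x + p y"
    and scale: "\<And>t x. t \<ge> 0 \<Longrightarrow> p (t *\<^sub>R x) = t * p x"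
    and S: "subspace S"
    and g_add: "\<And>x y. x \<in> S \<Longrightarrow> y \<in> S \<Longrightarrow> g (x + y) = g x + g y"
    and g_scale: "\<And>t x. x \<in> S \<Longrightarrow> g (t *\<^sub>R x) = t * g x"
    and g_le: "\<And>x. x \<in> S \<Longrightarrow> g x \<le> p x"
  obtains u where "linear u" "\<And>x. x \<in> S \<Longrightarrow> u x = g x" "\<And>x. u x \<le> p x"
proof -
  have p0: "p 0 = 0" using scale[of 0 0] by simp
  define G0 where "G0 = (\<lambda>x. (x, g x)) ` S"
  define \<A> where "\<A> = {G. subspace G \<and> G0 \<subseteq> G \<and> (\<forall>x a. (x, a) \<in> G \<longrightarrow> a \<le> p x)}"
  have "subspace G0"
    unfolding subspace_def
  proof (intro conjI ballI allI)
    have "g 0 = 0" using g_scale[OF subspace_0[OF S], of 0] by simp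
    then show "0 \<in> G0" using subspace_0[OF S] by (force simp: G0_def zero_prod_def)
  next
    fix v w assume "v \<in> G0" "w \<in> G0"
    then show "v + w \<in> G0" using S by (auto simp: G0_def image_iff g_add subspace_add)
  next
    fix t v assume "v \<in> G0"
    then show "t *\<^sub>R v \<in> G0" using S by (auto simp: G0_def image_iff g_scale subspace_scale)
  qed
  then have G0: "G0 \<in> \<A>" using g_le by (auto simp: \<A>_def G0_def)
  have "\<exists>M\<in>\<A>. \<forall>X\<in>\<A>. M \<subseteq> X \<longrightarrow> X = M"
  proof (rule subset_Zorn_nonempty)
    fix \<C> assume ne: "\<C> \<noteq> {}" and chain: "subset.chain \<A> \<C>"
    have C: "subspace X" "G0 \<subseteq> X" "\<And>x a. (x, a) \<in> X \<Longrightarrow> a \<le> p x" if "X \<in> \<C>" for X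
      using that chain by (auto simp: subset.chain_def \<A>_def)
    have "subspace (\<Union>\<C>)"
      unfolding subspace_def
    proof (intro conjI ballI allI)
      show "0 \<in> \<Union>\<C>" using ne C(1) subspace_0 by blast
    next
      fix v w assume "v \<in> \<Union>\<C>" "w \<in> \<Union>\<C>"
      then obtain X Y where "X \<in> \<C>" "Y \<in> \<C>" "v \<in> X" "w \<in> Y" by blast
      moreover from this have "X \<subseteq> Y \<or> Y \<subseteq> X"
        using chain by (auto simp: subset_chain_def)
      ultimately show "v + w \<in> \<Union>\<C>" using C(1) subspace_add by blast
    next
      fix t v assume "v \<in> \<Union>\<C>"
      then show "t *\<^sub>R v \<in> \<Union>\<C>" using C(1) subspace_scale by blast
    qed
    then show "\<Union>\<C> \<in> \<A>" using ne C(2,3) unfolding \<A>_def by blast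
  qed (use G0 in blast)
  then obtain G where "G \<in> \<A>" and max: "\<And>X. X \<in> \<A> \<Longrightarrow> G \<subseteq> X \<Longrightarrow> X = G" by blast
  then have G: "subspace G" and sub: "G0 \<subseteq> G" and le: "\<And>x a. (x, a) \<in> G \<Longrightarrow> a \<le> p x"
    by (auto simp: \<A>_def)
  \<comment> \<open>Maximality makes the domain everything: the extension by \<open>(x, c)\<close>
    is again admissible, so it equals \<open>G\<close> and \<open>(x, c)\<close> was in
    \<open>G\<close> already.\<close>
  have "\<exists>a. (x, a) \<in> G" for x
  proof -
    obtain c where c: "\<And>y a. (y, a) \<in> span (insert (x, c) G) \<Longrightarrow> a \<le> p y"
      using dominated_subspace_extend[OF add scale G le] by metis
    have *: "insert (x, c) G \<subseteq> span (insert (x, c) G)" by (rule span_superset)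
    then have "span (insert (x, c) G) \<in> \<A>" using c sub by (auto simp: \<A>_def)
    then have "span (insert (x, c) G) = G" using * by (intro max) auto
    then show ?thesis using * by auto
  qed
  then obtain u where u: "\<And>x. (x, u x) \<in> G" by metis
  have eq: "u x = a" if "(x, a) \<in> G" for x a
    using dominated_subspace_unique[of p G x "u x" a] p0 G le u that by blast
  show ?thesis
  proof
    show "linear u"
    proof (rule linearI)
      show "u (x + y) = u x + u y" for x y using subspace_add[OF G u u] by (intro eq) simp
      show "u (t *\<^sub>R x) = t *\<^sub>R u x" for t x using subspace_scale[OF G u] by (intro eq) simp
    qed
    show "u x = g x" if "x \<in> S" for x using that sub by (intro eq) (auto simp: G0_def)
    show "u x \<le> p x" for x using le u by blast
  qed
qed

section \<open>Bounded complex-linear functionals on a subspace and their extension\<close>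

lemma dual_on_boundE:
  assumes "F \<in> dual_on S"
  obtains M where "M > 0" "\<And>x. x \<in> S \<Longrightarrow> cmod (F x) \<le> M * norm x"
proof -
  have "\<exists>M. \<forall>x\<in>S. cmod (F x) \<le> M * norm x" using assms by (simp add: dual_on_def)
  then obtain M where M: "\<And>x. x \<in> S \<Longrightarrow> cmod (F x) \<le> M * norm x" by blast
  \<comment> \<open>The given \<open>M\<close> may be negative if \<open>S\<close> has no nonzero
    vector; BSE constants must be positive.\<close>
  have "cmod (F x) \<le> max 1 M * norm x" if "x \<in> S" for x
    using M[OF that] mult_right_mono[of M "max 1 M" "norm x"] by simp
  then show ?thesis using that[of "max 1 M"] by simp
qed

text \<open>A complex-linear \<open>F\<close> is recovered from \<open>u = Re \<circ> F\<close> as \<open>F x = u x - \<i> u (\<i> x)\<close>.\<close>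

lemma dual_on_extend:
  fixes S :: "'a::complex_normed_vector set"
  assumes S: "complex_vector.subspace S" and F: "F \<in> dual_on S"
  obtains f where "\<And>x. x \<in> S \<Longrightarrow> cdual_apply f x = F x"
proof -
  have F_add: "\<And>x y. x \<in> S \<Longrightarrow> y \<in> S \<Longrightarrow> F (x + y) = F x + F y"
    and F_scale: "\<And>c x. x \<in> S \<Longrightarrow> F (c *\<^sub>C x) = c * F x"
    using F by (auto simp: dual_on_def)
  obtain M where "M > 0" and M: "\<And>x. x \<in> S \<Longrightarrow> cmod (F x) \<le> M * norm x"
    using dual_on_boundE[OF F] by blast
  have S_real: "subspace S"
    using S by (simp add: complex_vector.subspace_def subspace_def scaleR_scaleC)
  obtain u where u: "linear u" "\<And>x. x \<in> S \<Longrightarrow> u x = Re (F x)" "\<And>x. u x \<le> M * norm x"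
  proof (rule Hahn_Banach[where p = "\<lambda>x. M * norm x" and g = "\<lambda>x. Re (F x)", OF _ _ S_real])
    show "M * norm (x + y) \<le> M * norm x + M * norm y" for x y :: 'a
      using mult_left_mono[OF norm_triangle_ineq, of M x y] \<open>M > 0\<close> by (simp add: distrib_left)
    show "Re (F x) \<le> M * norm x" if "x \<in> S" for x
      using M[OF that] complex_Re_le_cmod order_trans by blast
  qed (simp_all add: F_add F_scale scaleR_scaleC[of _ "_::'a"] norm_scaleC)
  have u_abs: "\<bar>u x\<bar> \<le> M * norm x" for x
    using u(3)[of x] u(3)[of "- x"] by (simp add: linear_neg[OF u(1)] abs_le_iff)
  define f where "f x = Complex (u x) (- u (\<i> *\<^sub>C x))" for x
  \<comment> \<open>\<open>u\<close> is only real-linear; this expresses its behaviour under complex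
    scalars by the two values that define \<open>f x\<close>, from which homogeneity of
    \<open>f\<close> is a computation.\<close>
  have u_scale: "u (c *\<^sub>C x) = Re c * u x + Im c * u (\<i> *\<^sub>C x)" for c x
  proof -
    have "c *\<^sub>C x = (complex_of_real (Re c) + complex_of_real (Im c) * \<i>) *\<^sub>C x"
      by (simp add: complex_eq mult.commute)
    then have "c *\<^sub>C x = Re c *\<^sub>R x + Im c *\<^sub>R (\<i> *\<^sub>C x)"
      by (simp only: scaleC_add_left scaleR_scaleC scaleC_scaleC)
    then show ?thesis by (simp add: linear_add[OF u(1)] linear_scale[OF u(1)])
  qed
  have f_add: "f (x + y) = f x + f y" for x y
    by (simp add: f_def complex_eq_iff scaleC_add_right linear_add[OF u(1)])
  have f_scale: "f (c *\<^sub>C x) = c * f x" for c x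
    by (simp add: f_def complex_eq_iff scaleC_scaleC u_scale[of c] u_scale[of "\<i> * c"] algebra_simps)
  \<comment> \<open>The factor 2 comes from adding the bounds for real and imaginary part; any
    constant suffices for membership in the dual.\<close>
  have f_bound: "cmod (f x) \<le> 2 * M * norm x" for x
    using cmod_le[of "f x"] u_abs[of x] u_abs[of "\<i> *\<^sub>C x"] by (simp add: f_def norm_scaleC)
  have "f \<in> dual_on UNIV"
    using f_bound unfolding dual_on_def by (auto simp: f_add f_scale)
  then obtain f' where f': "f = cdual_apply f'" by (auto simp: dual_on_UNIV)
  show ?thesis
  proof
    show "cdual_apply f' x = F x" if "x \<in> S" for x
      using that S by (simp add: f'[symmetric] f_def complex_eq_iff u(2) F_scale
          complex_vector.subspace_scale)
  qed
qed


section \<open>Weak topologies\<close>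

lemma Union_initial_subbasis:
  fixes f :: "'i \<Rightarrow> 'a \<Rightarrow> 'b::topological_space"
  shows "\<Union> {{x. f i x \<in> U} |i U. open U} = UNIV"
proof -
  have "{x. f undefined x \<in> UNIV} \<in> {{x. f i x \<in> U} |i U. open U}"
    using open_UNIV by blast
  then show ?thesis by (intro UNIV_eq_I[symmetric] UnionI[of "{x. f undefined x \<in> UNIV}"]) auto
qed

text \<open>The universal property of an initial topology, since preimages of subbasic sets decide
  continuity. It covers both topologies of the theorem: the index \<open>i\<close> is a functional
  for the weak one and a vector for the weak-* one.\<close>

lemma continuous_map_into_initial:
  fixes f :: "'i \<Rightarrow> 'a \<Rightarrow> 'b::topological_space"
  shows "continuous_map X (topology_generated_by {{x. f i x \<in> U} |i U. open U}) g \<longleftrightarrow>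
    (\<forall>i. continuous_map X euclidean (\<lambda>x. f i (g x)))"
proof -
  have "g -` {x. f i x \<in> U} \<inter> topspace X = {x \<in> topspace X. f i (g x) \<in> U}" for i U
    by auto
  moreover have "(\<forall>V. V \<in> {{x. f i x \<in> U} |i U. open U} \<longrightarrow> openin X (g -` V \<inter> topspace X)) \<longleftrightarrow>
      (\<forall>i U. open U \<longrightarrow> openin X (g -` {x. f i x \<in> U} \<inter> topspace X))"
    by blast
  ultimately show ?thesis
    unfolding continuous_on_generated_topo_iff Union_initial_subbasis by (simp add: continuous_map_def)
qed

lemma topspace_weak [simp]: "topspace weak_topology = UNIV"
  and topspace_weak_star [simp]: "topspace weak_star_topology = UNIV"
  unfolding weak_topology_def weak_star_topology_def topology_generated_by_topspace
  by (rule Union_initial_subbasis)+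

lemma continuous_map_into_weak:
  "continuous_map X weak_topology g \<longleftrightarrow>
    (\<forall>f. continuous_map X euclidean (\<lambda>x. cdual_apply f (g x)))"
  unfolding weak_topology_def by (rule continuous_map_into_initial)

lemma continuous_map_into_weak_star:
  "continuous_map X weak_star_topology g \<longleftrightarrow>
    (\<forall>x. continuous_map X euclidean (\<lambda>y. cdual_apply (g y) x))"
  unfolding weak_star_topology_def by (rule continuous_map_into_initial)

lemma continuous_map_weak: "continuous_map weak_topology euclidean (cdual_apply f)"
proof -
  have "continuous_map weak_topology weak_topology (\<lambda>x. x)" using continuous_map_id[of weak_topology] by (simp only: id_def)
  then show ?thesis unfolding continuous_map_into_weak by (rule spec)
qed

text \<open>The canonical embedding into the second dual; it makes the weak topology of a dual space
  finer than its weak-* topology.\<close>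

lemma eval_cdual:
  obtains f where "\<And>\<phi>. cdual_apply f \<phi> = cdual_apply \<phi> (x::'a::complex_normed_vector)"
proof -
  have "(\<lambda>\<phi>. cdual_apply \<phi> x) \<in> dual_on UNIV"
    unfolding dual_on_def using norm_cdual_apply_le[of _ x]
    by (auto intro!: exI[of _ "norm x"] simp: mult.commute)
  then show ?thesis using that unfolding dual_on_UNIV by (metis imageE)
qed

text \<open>The identity is always continuous from the weak to the weak-* topology, by
  \<open>eval_cdual\<close>. Equality therefore means continuity of the identity in the other
  direction, which the universal property tests on each element of the second dual.\<close>

lemma subtopology_weak_eq_weak_star_iff:
  fixes S :: "'a::complex_normed_vector cdual set"
  shows "subtopology weak_topology S = subtopology weak_star_topology S \<longleftrightarrow>
    (\<forall>f. continuous_map (subtopology weak_star_topology S) euclidean (cdual_apply f))"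
    (is "?W = ?W' \<longleftrightarrow> ?R")
proof
  assume "?W = ?W'"
  then show ?R using continuous_map_from_subtopology[OF continuous_map_weak] by metis
next
  assume R: ?R
  have W: "continuous_map ?W euclidean (\<lambda>\<phi>. cdual_apply \<phi> x)" for x
  proof -
    obtain f where "\<And>\<phi>. cdual_apply f \<phi> = cdual_apply \<phi> x" using eval_cdual by blast
    then have "(\<lambda>\<phi>. cdual_apply \<phi> x) = cdual_apply f" by auto
    then show ?thesis using continuous_map_from_subtopology[OF continuous_map_weak, of S f] by simp
  qed
  have "continuous_map ?W weak_star_topology id"
    using W unfolding continuous_map_into_weak_star by simp
  moreover have "continuous_map ?W' weak_topology id"
    using R unfolding continuous_map_into_weak by simp
  ultimately have "continuous_map ?W ?W' id" "continuous_map ?W' ?W id"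
    by (auto simp: continuous_map_in_subtopology)
  then show "?W = ?W'"
    by (simp add: topology_eq flip: topology_finer_continuous_id) blast
qed


section \<open>The canonical map\<close>

text \<open>The square of \<open>\<phi> a\<close> is \<open>\<phi> (a * a)\<close>, so that \<open>\<parallel>\<phi>\<parallel>\<^sup>2 \<le> \<parallel>\<phi>\<parallel>\<close>.\<close>

lemma norm_gelfand_le_1:
  assumes "\<phi> \<in> \<Delta>" shows "norm \<phi> \<le> 1"
proof -
  \<comment> \<open>The root of the estimate for the square of
    \<open>cmod (cdual_apply \<phi> a)\<close> is a bound linear in \<open>norm a\<close>, as
    \<open>onorm_bound\<close> requires.\<close>
  have "norm \<phi> \<le> sqrt (norm \<phi>)"
    unfolding norm_cdual.rep_eq[of \<phi>]
  proof (rule onorm_bound)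
    show "0 \<le> sqrt (onorm (cdual_apply \<phi>))" by (simp flip: norm_cdual.rep_eq)
    fix a
    have "(cmod (cdual_apply \<phi> a))\<^sup>2 = cmod (cdual_apply \<phi> (a * a))"
      using assms by (simp add: gelfand_space_def norm_mult power2_eq_square)
    also have "\<dots> \<le> norm \<phi> * norm (a * a)" by (rule norm_cdual_apply_le)
    also have "\<dots> \<le> norm \<phi> * (norm a)\<^sup>2"
      by (simp add: mult_left_mono norm_mult_ineq power2_eq_square)
    finally show "cmod (cdual_apply \<phi> a) \<le> sqrt (onorm (cdual_apply \<phi>)) * norm a"
      using real_le_rsqrt by (fastforce simp: real_sqrt_mult norm_cdual.rep_eq)
  qed
  then have "(norm \<phi>)\<^sup>2 \<le> norm \<phi>" by (metis norm_ge_zero power_mono real_sqrt_pow2)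
  then show ?thesis using norm_ge_zero[of \<phi>] by (cases "norm \<phi> = 0") (simp_all add: power2_eq_square)
qed

section \<open>Functionals on a linear span\<close>

lemma complex_span_as_sum:
  assumes "f \<in> complex_vector.span B"
  obtains n c \<phi> where "\<And>k. k < n \<Longrightarrow> \<phi> k \<in> B" "f = (\<Sum>k<n::nat. c k *\<^sub>C \<phi> k)"
proof -
  have "\<exists>n c \<phi>. (\<forall>k<n::nat. \<phi> k \<in> B) \<and> f = (\<Sum>k<n. c k *\<^sub>C \<phi> k)"
    using assms
  proof (induction rule: complex_vector.span_induct_alt)
    case base
    show ?case by (rule exI[of _ 0]) simp
  next
    case (step d \<psi> f)
    then obtain n c \<phi> where *: "\<forall>k<n::nat. \<phi> k \<in> B" "f = (\<Sum>k<n. c k *\<^sub>C \<phi> k)" by blast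
    show ?case
      \<comment> \<open>The new term takes the free index \<open>n\<close>. Repeated vectors are
        allowed, as in \<open>bse_bound\<close>, so \<open>\<psi>\<close> need not be compared with
        the earlier ones.\<close>
      by (intro exI[of _ "Suc n"] exI[of _ "c(n := d)"] exI[of _ "\<phi>(n := \<psi>)"])
        (use * step(1) in \<open>auto simp: less_Suc_eq\<close>)
  qed
  then show ?thesis using that by blast
qed

lemma dual_on_sum:
  fixes \<phi> :: "nat \<Rightarrow> 'a::complex_normed_vector"
  assumes F: "F \<in> dual_on S" and S: "complex_vector.subspace S" and "\<And>k. k < n \<Longrightarrow> \<phi> k \<in> S"
  shows "F (\<Sum>k<n. c k *\<^sub>C \<phi> k) = (\<Sum>k<n. c k * F (\<phi> k))"
  using assms(3)
proof (induction n)
  case 0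
  have "F (0 *\<^sub>C 0) = 0 * F 0"
    using F complex_vector.subspace_0[OF S] unfolding dual_on_def by blast
  then show ?case by simp
next
  case (Suc n)
  have "(\<Sum>k<n. c k *\<^sub>C \<phi> k) \<in> S"
    using Suc.prems S by (intro complex_vector.subspace_sum complex_vector.subspace_scale) auto
  then show ?case
    using Suc F S by (simp add: dual_on_def complex_vector.subspace_scale)
qed

text \<open>Reduces identities in the dual of the span to values at characters; points outside the
  span are settled by extensionality.\<close>

lemma dual_on_span_eqI:
  assumes F: "F \<in> dual_on (complex_vector.span B)" and G: "G \<in> dual_on (complex_vector.span B)"
    and eq: "\<And>x. x \<in> B \<Longrightarrow> F x = G x"
  shows "F = G"
proof (rule extensionalityI[of _ "complex_vector.span B"])
  fix x assume "x \<in> complex_vector.span B"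
  then obtain n c \<phi> where "\<And>k. k < n \<Longrightarrow> \<phi> k \<in> B" "x = (\<Sum>k<n::nat. c k *\<^sub>C \<phi> k)"
    using complex_span_as_sum by blast
  then show "F x = G x"
    using eq dual_on_sum[OF F] dual_on_sum[OF G]
    by (simp add: complex_vector.span_base)
qed (use F G in \<open>simp_all add: dual_on_def\<close>)

section \<open>The functional attached to a BSE-function, its norm, and the way back\<close>

lemma bse_to_dual_gelfand:
  assumes "\<sigma> \<in> bse_functions" "\<phi> \<in> \<Delta>"
  shows "bse_to_dual \<sigma> \<phi> = \<sigma> \<phi>"
  using bse_to_dual_sum[OF assms(1), of 1 "\<lambda>_. \<phi>" "\<lambda>_. 1"] assms(2) by simp

text \<open>Every element of the span is one of the sums in the BSE condition, and
  \<open>bse_to_dual_sum\<close> evaluates the functional there. BSE constants and bounds of the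
  functional are thus the same numbers.\<close>

lemma bse_bound_iff:
  assumes "\<sigma> \<in> bse_functions"
  shows "bse_bound \<sigma> M \<longleftrightarrow> (\<forall>f\<in>\<langle>\<Delta>\<rangle>. cmod (bse_to_dual \<sigma> f) \<le> M * norm f)"
proof
  assume M: "bse_bound \<sigma> M"
  show "\<forall>f\<in>\<langle>\<Delta>\<rangle>. cmod (bse_to_dual \<sigma> f) \<le> M * norm f"
  proof
    fix f :: "'a cdual" assume "f \<in> \<langle>\<Delta>\<rangle>"
    then obtain n c \<phi> where *: "\<And>k. k < n \<Longrightarrow> \<phi> k \<in> \<Delta>" "f = (\<Sum>k<n::nat. c k *\<^sub>C \<phi> k)"
      using complex_span_as_sum by blast
    then show "cmod (bse_to_dual \<sigma> f) \<le> M * norm f"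
      using M bse_to_dual_sum[OF assms *(1)] by (simp add: bse_bound_def)
  qed
next
  assume *: "\<forall>f\<in>\<langle>\<Delta>\<rangle>. cmod (bse_to_dual \<sigma> f) \<le> M * norm f"
  show "bse_bound \<sigma> M"
    unfolding bse_bound_def
  proof (intro allI impI)
    fix n c \<phi> assume \<phi>: "\<forall>j<n::nat. \<phi> j \<in> (\<Delta> :: 'a cdual set)"
    then have "(\<Sum>j<n. c j *\<^sub>C \<phi> j) \<in> \<langle>\<Delta>\<rangle>"
      by (intro complex_vector.span_sum complex_vector.span_scale complex_vector.span_base) simp
    then show "cmod (\<Sum>j<n. c j * \<sigma> (\<phi> j)) \<le> M * norm (\<Sum>j<n. c j *\<^sub>C \<phi> j)"
      using * bse_to_dual_sum[OF assms, of n \<phi> c] \<phi> by auto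
  qed
qed

lemma bse_to_dual_in_dual_on:
  assumes \<sigma>: "\<sigma> \<in> bse_functions"
  shows "bse_to_dual \<sigma> \<in> dual_on \<langle>\<Delta>\<rangle>"
proof -
  \<comment> \<open>The definition picks a value through representations, so linearity is not
    visible in it. Appending one term to a representation of \<open>f\<close> gives the form that
    induction over the span can use.\<close>
  have step: "bse_to_dual \<sigma> (d *\<^sub>C \<psi> + f) = d * \<sigma> \<psi> + bse_to_dual \<sigma> f"
    if \<psi>: "\<psi> \<in> \<Delta>" and f: "f \<in> \<langle>\<Delta>\<rangle>" for d \<psi> f
  proof -
    obtain n c \<phi> where *: "\<And>k. k < n \<Longrightarrow> \<phi> k \<in> \<Delta>" "f = (\<Sum>k<n::nat. c k *\<^sub>C \<phi> k)"
      using complex_span_as_sum[OF f] by blast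
    have "bse_to_dual \<sigma> (\<Sum>k<Suc n. (c(n := d)) k *\<^sub>C (\<phi>(n := \<psi>)) k)
        = (\<Sum>k<Suc n. (c(n := d)) k * \<sigma> ((\<phi>(n := \<psi>)) k))"
      by (rule bse_to_dual_sum[OF \<sigma>]) (use * \<psi> in auto)
    then show ?thesis using * bse_to_dual_sum[OF \<sigma> *(1)] by (simp add: add.commute)
  qed
  have zero: "bse_to_dual \<sigma> 0 = 0" using bse_to_dual_sum[OF \<sigma>, of 0] by simp
  have "bse_to_dual \<sigma> (f + g) = bse_to_dual \<sigma> f + bse_to_dual \<sigma> g"
    if "f \<in> \<langle>\<Delta>\<rangle>" and g: "g \<in> \<langle>\<Delta>\<rangle>" for f g
  proof -
    \<comment> \<open>Membership is carried through the induction because \<open>step\<close> asks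
      for it and the induction rule does not provide it.\<close>
    have "f \<in> \<langle>\<Delta>\<rangle> \<and> bse_to_dual \<sigma> (f + g) = bse_to_dual \<sigma> f + bse_to_dual \<sigma> g"
      using that(1)
      by (induction rule: complex_vector.span_induct_alt)
        (auto simp: zero step g add.assoc complex_vector.span_zero complex_vector.span_add
          complex_vector.span_scale complex_vector.span_base)
    then show ?thesis ..
  qed
  moreover have "bse_to_dual \<sigma> (c *\<^sub>C f) = c * bse_to_dual \<sigma> f" if "f \<in> \<langle>\<Delta>\<rangle>" for c f
  proof -
    have "f \<in> \<langle>\<Delta>\<rangle> \<and> bse_to_dual \<sigma> (c *\<^sub>C f) = c * bse_to_dual \<sigma> f"
      using that
      by (induction rule: complex_vector.span_induct_alt)
        (auto simp: zero step scaleC_add_right scaleC_scaleC distrib_left complex_vector.span_zero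
          complex_vector.span_add complex_vector.span_scale complex_vector.span_base)
    then show ?thesis ..
  qed
  moreover have "\<exists>M. \<forall>f\<in>\<langle>\<Delta>\<rangle>. cmod (bse_to_dual \<sigma> f) \<le> M * norm f"
    using \<sigma> bse_bound_iff[OF \<sigma>] by (auto simp: bse_functions_def)
  moreover have "bse_to_dual \<sigma> \<in> extensional \<langle>\<Delta>\<rangle>" by (simp add: bse_to_dual_def)
  ultimately show ?thesis by (simp add: dual_on_def)
qed

text \<open>By \<open>bse_bound_iff\<close>, the right-hand side is the form that
  \<open>bse_norm\<close> takes. Scaling to the unit ball shows that the supremum is itself a bound,
  and it lies below every other one.\<close>

lemma dual_norm_on_eq_Inf:
  assumes F: "F \<in> dual_on S" and S: "complex_vector.subspace S"
  shows "dual_norm_on S F = Inf {M. M > 0 \<and> (\<forall>x\<in>S. cmod (F x) \<le> M * norm x)}"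
proof -
  define Ms where "Ms = {M. M > 0 \<and> (\<forall>x\<in>S. cmod (F x) \<le> M * norm x)}"
  define Vs where "Vs = {cmod (F x) |x. x \<in> S \<and> norm x \<le> 1}"
  have F_scale: "\<And>c x. x \<in> S \<Longrightarrow> F (c *\<^sub>C x) = c * F x" using F by (auto simp: dual_on_def)
  have 0: "0 \<in> S" using complex_vector.subspace_0[OF S] .
  have F0: "F 0 = 0" using F_scale[OF 0, of 0] by simp
  obtain M0 where "M0 > 0" "\<And>x. x \<in> S \<Longrightarrow> cmod (F x) \<le> M0 * norm x"
    using dual_on_boundE[OF F] by blast
  then have M0: "M0 \<in> Ms" by (simp add: Ms_def)
  then have Ms: "Ms \<noteq> {}" by blast
  have zero: "0 \<in> Vs" unfolding Vs_def using 0 F0 by (intro CollectI exI[of _ 0]) simp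
  then have Vs: "Vs \<noteq> {}" by blast
  have le: "v \<le> M" if "v \<in> Vs" "M \<in> Ms" for v M
  proof -
    obtain x where x: "v = cmod (F x)" "x \<in> S" "norm x \<le> 1" using \<open>v \<in> Vs\<close> by (auto simp: Vs_def)
    then have "v \<le> M * norm x" "M > 0" using \<open>M \<in> Ms\<close> by (auto simp: Ms_def)
    moreover from this have "M * norm x \<le> M * 1" using x(3) by (intro mult_left_mono) simp_all
    ultimately show ?thesis by linarith
  qed
  have bdd: "bdd_above Vs" by (rule bdd_aboveI) (rule le[OF _ M0])
  have bdd': "bdd_below Ms" by (rule bdd_belowI[of _ 0]) (simp add: Ms_def)
  have pos: "0 \<le> Sup Vs" by (rule cSup_upper[OF zero bdd])
  have bound: "cmod (F x) \<le> Sup Vs * norm x" if x: "x \<in> S" for x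
  proof (cases "x = 0")
    case False
    have "cmod (F (complex_of_real (inverse (norm x)) *\<^sub>C x)) \<in> Vs"
      unfolding Vs_def using x S False
      by (intro CollectI exI[of _ "complex_of_real (inverse (norm x)) *\<^sub>C x"])
        (simp add: complex_vector.subspace_scale norm_scaleC norm_inverse)
    then have "cmod (F (complex_of_real (inverse (norm x)) *\<^sub>C x)) \<le> Sup Vs"
      by (rule cSup_upper[OF _ bdd])
    then show ?thesis using False x by (simp add: F_scale norm_mult norm_divide norm_inverse field_simps)
  qed (simp add: F0)
  have "Inf Ms \<le> Sup Vs"
  \<comment> \<open>The constants in \<open>Ms\<close> are positive, while the supremum is 0 for the
    zero functional; hence the detour through \<open>Sup Vs + e\<close>.\<close>
  proof (rule field_le_epsilon)
    fix e :: real assume e: "e > 0"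
    have "cmod (F x) \<le> (Sup Vs + e) * norm x" if "x \<in> S" for x
      unfolding distrib_right using e by (intro add_increasing2 bound that) simp
    moreover have "Sup Vs + e > 0" using e pos by linarith
    ultimately have "Sup Vs + e \<in> Ms" unfolding Ms_def by blast
    then show "Inf Ms \<le> Sup Vs + e" by (rule cInf_lower[OF _ bdd'])
  qed
  moreover have "Sup Vs \<le> Inf Ms"
    by (rule cInf_greatest[OF Ms], rule cSup_least[OF Vs]) (rule le)
  ultimately show ?thesis by (simp add: dual_norm_on_def Vs_def Ms_def)
qed

lemma dual_norm_bse_to_dual:
  assumes "\<sigma> \<in> bse_functions"
  shows "dual_norm_on \<langle>\<Delta>\<rangle> (bse_to_dual \<sigma>) = bse_norm \<sigma>"
  using dual_norm_on_eq_Inf[OF bse_to_dual_in_dual_on[OF assms] complex_vector.subspace_span]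
  by (simp add: bse_norm_def bse_bound_iff[OF assms])

text \<open>A bound \<open>M\<close> of \<open>F\<close> on the span is a BSE constant for the
  restriction, and it bounds the restriction since \<Delta> lies in the unit ball. What remains of
  the BSE conditions is continuity, which sees only the values on \<Delta>.\<close>

lemma restrict_in_bse_functions_iff:
  assumes F: "F \<in> dual_on \<langle>\<Delta>\<rangle>"
  shows "restrict F \<Delta> \<in> bse_functions \<longleftrightarrow>
    continuous_map (subtopology weak_star_topology \<Delta>) euclidean F"
proof -
  obtain M where M: "M > 0" "\<And>f. f \<in> \<langle>\<Delta>\<rangle> \<Longrightarrow> cmod (F f) \<le> M * norm f"
    using dual_on_boundE[OF F] by blast
  have "bounded (restrict F \<Delta> ` \<Delta>)"
  proof (rule boundedI)
    fix z assume "z \<in> restrict F \<Delta> ` \<Delta>"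
    then obtain \<phi> where \<phi>: "\<phi> \<in> \<Delta>" "z = F \<phi>" by auto
    have "cmod (F \<phi>) \<le> M * norm \<phi>" using M(2) \<phi>(1) complex_vector.span_base by blast
    also have "\<dots> \<le> M" using M(1) norm_gelfand_le_1[OF \<phi>(1)] by simp
    finally show "cmod z \<le> M" using \<phi>(2) by simp
  qed
  moreover have "bse_bound (restrict F \<Delta>) M"
    unfolding bse_bound_def
  proof (intro allI impI)
    fix n c \<phi> assume \<phi>: "\<forall>j<n::nat. \<phi> j \<in> (\<Delta> :: 'a cdual set)"
    then have "(\<Sum>j<n. c j *\<^sub>C \<phi> j) \<in> \<langle>\<Delta>\<rangle>"
      by (intro complex_vector.span_sum complex_vector.span_scale complex_vector.span_base) simp
    moreover have "F (\<Sum>j<n. c j *\<^sub>C \<phi> j) = (\<Sum>j<n. c j * restrict F \<Delta> (\<phi> j))"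
      using \<phi> by (subst dual_on_sum[OF F complex_vector.subspace_span])
        (simp_all add: complex_vector.span_base)
    ultimately show "cmod (\<Sum>j<n. c j * restrict F \<Delta> (\<phi> j)) \<le> M * norm (\<Sum>j<n. c j *\<^sub>C \<phi> j)"
      using M(2) by metis
  qed
  moreover have "continuous_map (subtopology weak_star_topology \<Delta>) euclidean (restrict F \<Delta>)
      \<longleftrightarrow> continuous_map (subtopology weak_star_topology \<Delta>) euclidean F"
    by (intro iffI; erule continuous_map_eq) simp_all
  ultimately show ?thesis using M(1) by (auto simp: bse_functions_def)
qed

lemma bse_to_dual_restrict:
  assumes "F \<in> dual_on \<langle>\<Delta>\<rangle>" "restrict F \<Delta> \<in> bse_functions"
  shows "bse_to_dual (restrict F \<Delta>) = F"
  by (rule dual_on_span_eqI[OF bse_to_dual_in_dual_on[OF assms(2)] assms(1)])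
    (simp add: bse_to_dual_gelfand[OF assms(2)])

text \<open>The functional \<open>F\<close> supplies boundedness and the BSE inequality for
  \<open>\<sigma>\<close>. In this way sums, multiples and products of BSE-functions inherit the BSE
  property from the dual of the span.\<close>

lemma bse_to_dual_eqI:
  assumes \<sigma>: "\<sigma> \<in> extensional \<Delta>" and F: "F \<in> dual_on \<langle>\<Delta>\<rangle>"
    and eq: "\<And>\<phi>. \<phi> \<in> \<Delta> \<Longrightarrow> F \<phi> = \<sigma> \<phi>"
    and cont: "continuous_map (subtopology weak_star_topology \<Delta>) euclidean \<sigma>"
  shows "bse_to_dual \<sigma> = F"
proof -
  have \<sigma>_eq: "restrict F \<Delta> = \<sigma>"
    by (rule extensionalityI[OF restrict_extensional \<sigma>]) (simp add: eq)
  have "continuous_map (subtopology weak_star_topology \<Delta>) euclidean F"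
    by (rule continuous_map_eq[OF cont]) (simp add: eq)
  then have "restrict F \<Delta> \<in> bse_functions" using restrict_in_bse_functions_iff[OF F] by simp
  then show ?thesis using bse_to_dual_restrict[OF F] \<sigma>_eq by simp
qed

section \<open>Stability of the dual under its operations\<close>

lemma dual_on_add:
  assumes "complex_vector.subspace S" "F \<in> dual_on S" "G \<in> dual_on S"
  shows "(\<lambda>f\<in>S. F f + G f) \<in> dual_on S"
proof -
  obtain M N where "\<And>f. f \<in> S \<Longrightarrow> cmod (F f) \<le> M * norm f"
    "\<And>f. f \<in> S \<Longrightarrow> cmod (G f) \<le> N * norm f"
    using assms(2,3) dual_on_boundE by metis
  then have "cmod (F f + G f) \<le> (M + N) * norm f" if "f \<in> S" for f
    using norm_triangle_mono that by (fastforce simp: distrib_right)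
  then show ?thesis
    using assms by (auto simp: dual_on_def complex_vector.subspace_add
        complex_vector.subspace_scale distrib_left)
qed

lemma dual_on_scale:
  assumes "complex_vector.subspace S" "F \<in> dual_on S"
  shows "(\<lambda>f\<in>S. c * F f) \<in> dual_on S"
proof -
  obtain M where "\<And>f. f \<in> S \<Longrightarrow> cmod (F f) \<le> M * norm f"
    using assms(2) dual_on_boundE by metis
  then have "cmod (c * F f) \<le> (cmod c * M) * norm f" if "f \<in> S" for f
    using that by (simp add: norm_mult mult.assoc mult_left_mono)
  then show ?thesis
    using assms by (auto simp: dual_on_def complex_vector.subspace_add
        complex_vector.subspace_scale distrib_left)
qed

lemma cdual_norm_le:
  assumes "0 \<le> M" "\<And>x. cmod (cdual_apply f x) \<le> M * norm x"
  shows "norm f \<le> M"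
  using assms by (simp add: norm_cdual.rep_eq onorm_bound)

lemma norm_arens_act_right_le: "norm (arens_act_right f a) \<le> norm f * norm a"
proof (rule cdual_norm_le)
  fix b
  have "cmod (cdual_apply (arens_act_right f a) b) \<le> norm f * norm (a * b)"
    by (simp add: norm_cdual_apply_le)
  also have "\<dots> \<le> norm f * (norm a * norm b)" by (simp add: mult_left_mono norm_mult_ineq)
  finally show "cmod (cdual_apply (arens_act_right f a) b) \<le> norm f * norm a * norm b"
    by (simp add: mult.assoc)
qed simp

text \<open>If \<open>M\<close> and \<open>N\<close> bound \<open>F\<close> and \<open>G\<close>,
  submultiplicativity of the norm of the algebra bounds \<open>arens_act_left G f\<close> by
  \<open>N * norm f\<close>, so \<open>M * N\<close> bounds the product.\<close>

lemma arens_in_dual_on: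
  assumes F: "F \<in> dual_on \<langle>\<Delta>\<rangle>" and G: "G \<in> dual_on \<langle>\<Delta>\<rangle>"
  shows "arens \<langle>\<Delta>\<rangle> F G \<in> dual_on \<langle>\<Delta>\<rangle>"
proof -
  \<comment> \<open>\<open>Abs_cdual\<close> can be undone only on bounded linear functions;
    \<open>arens_act_left_span_ex\<close> provides the functional represented here.\<close>
  have apply_left: "cdual_apply (arens_act_left G f) a = G (arens_act_right f a)"
    if f: "f \<in> \<langle>\<Delta>\<rangle>" for f a
  proof -
    obtain g where g: "\<forall>a. cdual_apply g a = G (arens_act_right f a)"
      using arens_act_left_span_ex[OF G f] by blast
    then have "(\<lambda>a. G (arens_act_right f a)) = cdual_apply g" by auto
    then show ?thesis using g by (simp add: arens_act_left_def cdual_apply_inverse)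
  qed
  have G_add: "G (x + y) = G x + G y" and G_scale: "G (c *\<^sub>C x) = c * G x"
    if "x \<in> \<langle>\<Delta>\<rangle>" "y \<in> \<langle>\<Delta>\<rangle>" for c x y
    using G that by (simp_all add: dual_on_def)
  have add: "arens_act_left G (f + g) = arens_act_left G f + arens_act_left G g"
    if "f \<in> \<langle>\<Delta>\<rangle>" "g \<in> \<langle>\<Delta>\<rangle>" for f g
    by (rule cdual_eqI)
      (simp add: that apply_left complex_vector.span_add arens_act_right_add G_add arens_act_right_span)
  have scale: "arens_act_left G (c *\<^sub>C f) = c *\<^sub>C arens_act_left G f" if "f \<in> \<langle>\<Delta>\<rangle>" for c f
    by (rule cdual_eqI)
      (simp add: that apply_left complex_vector.span_scale arens_act_right_scaleC
        G_scale[OF _ complex_vector.span_zero] arens_act_right_span)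
  obtain M where "M > 0" and M: "\<And>f. f \<in> \<langle>\<Delta>\<rangle> \<Longrightarrow> cmod (F f) \<le> M * norm f"
    using dual_on_boundE[OF F] by blast
  obtain N where "N > 0" and N: "\<And>f. f \<in> \<langle>\<Delta>\<rangle> \<Longrightarrow> cmod (G f) \<le> N * norm f"
    using dual_on_boundE[OF G] by blast
  have "norm (arens_act_left G f) \<le> N * norm f" if f: "f \<in> \<langle>\<Delta>\<rangle>" for f
  proof (rule cdual_norm_le)
    fix a
    have "cmod (G (arens_act_right f a)) \<le> N * norm (arens_act_right f a)"
      by (rule N[OF arens_act_right_span[OF f]])
    also have "\<dots> \<le> N * (norm f * norm a)" by (simp add: \<open>N > 0\<close> less_imp_le norm_arens_act_right_le)
    finally show "cmod (cdual_apply (arens_act_left G f) a) \<le> N * norm f * norm a"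
      by (simp add: apply_left[OF f] mult.assoc)
  qed (simp add: \<open>N > 0\<close> less_imp_le)
  then have "cmod (F (arens_act_left G f)) \<le> M * N * norm f" if "f \<in> \<langle>\<Delta>\<rangle>" for f
    using that M[OF arens_act_left_span[OF G that]]
    using \<open>M > 0\<close> by (metis less_imp_le mult.assoc mult_left_mono order_trans)
  then have "\<exists>K. \<forall>f\<in>\<langle>\<Delta>\<rangle>. cmod (arens \<langle>\<Delta>\<rangle> F G f) \<le> K * norm f"
    by (auto simp: arens_def)
  then show ?thesis
    using F arens_act_left_span[OF G]
    by (simp add: dual_on_def arens_def add scale complex_vector.span_add complex_vector.span_scale)
qed

section \<open>Reduction of (i) to surjectivity, then to continuity\<close>

lemma continuous_map_mult:
  fixes f g :: "'a \<Rightarrow> 'b::real_normed_algebra"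
  assumes "continuous_map X euclidean f" "continuous_map X euclidean g"
  shows "continuous_map X euclidean (\<lambda>x. f x * g x)"
  using assms by (simp add: continuous_map_atin tendsto_mult)

text \<open>Values at characters recover \<open>\<sigma>\<close>, which gives injectivity. They also
  reduce each algebraic identity to a pointwise one on \<Delta>, through
  \<open>bse_to_dual_eqI\<close> and, for the product, \<open>arens_gelfand\<close>.\<close>

lemma isometric_algebra_iso_bse_to_dual_iff:
  "isometric_algebra_iso (C_BSE :: ('a::complex_banach_algebra cdual \<Rightarrow> complex) normed_alg)
      dual_span_gelfand bse_to_dual \<longleftrightarrow>
    (dual_on \<langle>\<Delta>\<rangle> :: ('a cdual \<Rightarrow> complex) set) \<subseteq> bse_to_dual ` bse_functions"
    (is "?iso \<longleftrightarrow> ?surj")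
proof
  assume ?iso
  then show ?surj
    by (auto simp: isometric_algebra_iso_def C_BSE_def dual_span_gelfand_def bij_betw_def)
next
  assume ?surj
  let ?B = "bse_functions :: ('a cdual \<Rightarrow> complex) set"
  have sub: "complex_vector.subspace (\<langle>\<Delta>\<rangle> :: 'a cdual set)"
    by (rule complex_vector.subspace_span)
  have dual: "bse_to_dual \<sigma> \<in> dual_on \<langle>\<Delta>\<rangle>" if "\<sigma> \<in> ?B" for \<sigma>
    using that by (rule bse_to_dual_in_dual_on)
  have ext: "\<sigma> \<in> extensional \<Delta>"
    and cont: "continuous_map (subtopology weak_star_topology \<Delta>) euclidean \<sigma>" if "\<sigma> \<in> ?B" for \<sigma>
    using that by (simp_all add: bse_functions_def)
  have base: "\<phi> \<in> \<langle>\<Delta>\<rangle>" if "\<phi> \<in> \<Delta>" for \<phi> :: "'a cdual"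
    using that by (rule complex_vector.span_base)
  have cont_restrict: "continuous_map (subtopology weak_star_topology \<Delta>) euclidean (restrict \<sigma> \<Delta>)"
    if "continuous_map (subtopology weak_star_topology \<Delta>) euclidean \<sigma>"
    for \<sigma> :: "'a cdual \<Rightarrow> complex"
    by (rule continuous_map_eq[OF that]) simp
  have "inj_on bse_to_dual ?B"
  proof (rule inj_onI)
    fix \<sigma> \<tau> assume "\<sigma> \<in> ?B" "\<tau> \<in> ?B" "bse_to_dual \<sigma> = bse_to_dual \<tau>"
    then show "\<sigma> = \<tau>"
      by (intro extensionalityI[OF ext ext]) (metis bse_to_dual_gelfand)+
  qed
  moreover have "bse_to_dual ` ?B = dual_on \<langle>\<Delta>\<rangle>" using \<open>?surj\<close> dual by blast
  moreover have "bse_to_dual (\<lambda>\<phi>\<in>\<Delta>. \<sigma> \<phi> + \<tau> \<phi>) = (\<lambda>f\<in>\<langle>\<Delta>\<rangle>. bse_to_dual \<sigma> f + bse_to_dual \<tau> f)"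
    if "\<sigma> \<in> ?B" "\<tau> \<in> ?B" for \<sigma> \<tau>
    by (rule bse_to_dual_eqI[OF restrict_extensional dual_on_add[OF sub dual dual]])
      (simp_all add: that base bse_to_dual_gelfand cont_restrict continuous_map_add cont)
  moreover have "bse_to_dual (\<lambda>\<phi>\<in>\<Delta>. c * \<sigma> \<phi>) = (\<lambda>f\<in>\<langle>\<Delta>\<rangle>. c * bse_to_dual \<sigma> f)"
    if "\<sigma> \<in> ?B" for c \<sigma>
    by (rule bse_to_dual_eqI[OF restrict_extensional dual_on_scale[OF sub dual]])
      (simp_all add: that base bse_to_dual_gelfand cont_restrict continuous_map_mult cont)
  moreover have "bse_to_dual (\<lambda>\<phi>\<in>\<Delta>. \<sigma> \<phi> * \<tau> \<phi>) = arens \<langle>\<Delta>\<rangle> (bse_to_dual \<sigma>) (bse_to_dual \<tau>)"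
    if "\<sigma> \<in> ?B" "\<tau> \<in> ?B" for \<sigma> \<tau>
    by (rule bse_to_dual_eqI[OF restrict_extensional arens_in_dual_on[OF dual dual]])
      (simp_all add: that arens_gelfand dual bse_to_dual_gelfand cont_restrict continuous_map_mult cont)
  moreover have "dual_norm_on \<langle>\<Delta>\<rangle> (bse_to_dual \<sigma>) = bse_norm \<sigma>" if "\<sigma> \<in> ?B" for \<sigma>
    using that by (rule dual_norm_bse_to_dual)
  ultimately show ?iso
    by (simp add: isometric_algebra_iso_def C_BSE_def dual_span_gelfand_def bij_betw_def)
qed

text \<open>A functional in the image agrees on \<Delta> with the continuous function it comes from;
  a functional continuous on \<Delta> is the image of its own restriction.\<close>

lemma dual_on_subset_image_bse_to_dual_iff:
  "(dual_on \<langle>\<Delta>\<rangle> :: ('a::complex_banach_algebra cdual \<Rightarrow> complex) set) \<subseteq>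
      bse_to_dual ` bse_functions \<longleftrightarrow>
    (\<forall>F\<in>dual_on \<langle>\<Delta>\<rangle>.
      continuous_map (subtopology weak_star_topology \<Delta>) euclidean (F :: 'a cdual \<Rightarrow> complex))"
    (is "?L \<longleftrightarrow> ?R")
proof
  assume ?L
  show ?R
  proof
    fix F :: "'a cdual \<Rightarrow> complex" assume "F \<in> dual_on \<langle>\<Delta>\<rangle>"
    then obtain \<sigma> where \<sigma>: "\<sigma> \<in> bse_functions" "F = bse_to_dual \<sigma>" using \<open>?L\<close> by blast
    then have "continuous_map (subtopology weak_star_topology \<Delta>) euclidean \<sigma>"
      by (simp add: bse_functions_def)
    then show "continuous_map (subtopology weak_star_topology \<Delta>) euclidean F"
      by (rule continuous_map_eq) (simp add: \<sigma> bse_to_dual_gelfand)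
  qed
next
  assume ?R
  then show ?L
    using restrict_in_bse_functions_iff bse_to_dual_restrict by (metis image_eqI subsetI)
qed

theorem theorem2p3:
  assumes "(\<Delta> :: 'a::{complex_banach_algebra, comm_ring} cdual set) \<noteq> {}"
  shows "isometric_algebra_iso (C_BSE :: ('a cdual \<Rightarrow> complex) normed_alg) dual_span_gelfand bse_to_dual
    \<longleftrightarrow> subtopology weak_topology (\<Delta> :: 'a cdual set) = subtopology weak_star_topology \<Delta>"
proof -
  let ?cont = "\<lambda>F :: 'a cdual \<Rightarrow> complex.
    continuous_map (subtopology weak_star_topology \<Delta>) euclidean F"
  have "?cont (cdual_apply f)" if "\<forall>F\<in>dual_on \<langle>\<Delta>\<rangle>. ?cont F" for f
  proof -
    have "?cont (restrict (cdual_apply f) \<langle>\<Delta>\<rangle>)"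
      using that restrict_dual_on[of "cdual_apply f"] by (simp add: dual_on_UNIV)
    then show ?thesis
      by (rule continuous_map_eq) (simp add: complex_vector.span_base)
  qed
  \<comment> \<open>The direction that rests on Hahn-Banach: \<open>F\<close> extends to an element
    of the second dual with the same values on \<Delta>. The converse above only restricts to the
    span.\<close>
  moreover have "?cont F" if ev: "\<forall>f. ?cont (cdual_apply f)" and F: "F \<in> dual_on \<langle>\<Delta>\<rangle>" for F
  proof -
    obtain f where f: "\<And>x. x \<in> \<langle>\<Delta>\<rangle> \<Longrightarrow> cdual_apply f x = F x"
      using dual_on_extend[OF complex_vector.subspace_span F] by blast
    show ?thesis
      by (rule continuous_map_eq[OF ev[rule_format, of f]]) (simp add: f complex_vector.span_base)
  qed
  ultimately show ?thesis
    unfolding isometric_algebra_iso_bse_to_dual_iff dual_on_subset_image_bse_to_dual_iff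
      subtopology_weak_eq_weak_star_iff by blast
qed

end
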